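(* There exist absolute constants $C,c>0$ such that for any positive integers $n$ and $d$, if $f_{n,d}$ is uniformly chosen from $\mathrm{Hom}(P_{n,d},0)$, then $$\max\{ck2^{-d},1\}\le \mathrm{Var}(f_{n,d}(k))\le Ck2^{-d}+4,\qquad 1\le k\le n.$$
   Context: For $n,d\ge 1$, $P_{n,d}$ is the graph with vertex set $\{0,1,\dots,n\}$ in which $i,j$ are adjacent iff $|i-j|\in\{1,3,\dots,2d+1\}$. $\mathrm{Hom}(P_{n,d},0)$ is the finite set of functions $f\colon\{0,\dots,n\}\to\mathbb{Z}$ with $f(0)=0$ and $|f(i)-f(j)|=1$ whenever $i,j$ are adjacent in $P_{n,d}$. *)

theory Defs
  imports "HOL-Probability.Probability"
begin

definition P_verts :: "nat \<Rightarrow> nat set" where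
  "P_verts n = {0..n}"

definition P_adj :: "nat \<Rightarrow> nat \<Rightarrow> nat \<Rightarrow> nat \<Rightarrow> bool" where
  "P_adj n d i j \<longleftrightarrow> i \<in> P_verts n \<and> j \<in> P_verts n \<and>
     \<bar>int i - int j\<bar> \<in> {2 * int m + 1 | m. m \<le> d}"

text \<open>Functions on the vertex set are taken to be \<open>undefined\<close> outside it, so that
  each function on \<open>{0, \<dots>, n}\<close> is counted exactly once.\<close>

definition Hom_P :: "nat \<Rightarrow> nat \<Rightarrow> (nat \<Rightarrow> int) set" where
  "Hom_P n d = {f \<in> P_verts n \<rightarrow>\<^sub>E UNIV. f 0 = 0 \<and>
     (\<forall>i j. P_adj n d i j \<longrightarrow> \<bar>f i - f j\<bar> = 1)}"

text \<open>The next two facts are what makes \<open>pmf_of_set (Hom_P n d)\<close> the uniform distribution.\<close>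

lemma finite_Hom_P: "finite (Hom_P n d)"
proof (rule finite_subset)
  show "Hom_P n d \<subseteq> (\<Pi>\<^sub>E i\<in>{0..n}. {- int n..int n})"
  proof
    fix f assume f: "f \<in> Hom_P n d"
    have step: "\<bar>f (Suc i) - f i\<bar> = 1" if "Suc i \<le> n" for i
    proof -
      have "\<bar>int (Suc i) - int i\<bar> = 2 * int 0 + 1" by simp
      then have "P_adj n d (Suc i) i"
        using that unfolding P_adj_def P_verts_def by fastforce
      then show ?thesis using f by (simp add: Hom_P_def)
    qed
    have bound: "i \<le> n \<Longrightarrow> \<bar>f i\<bar> \<le> int i" for i
    proof (induction i)
      case 0
      then show ?case using f by (simp add: Hom_P_def)
    next
      case (Suc i)
      then show ?case using step[of i] by simp
    qed
    have "f i \<in> {- int n..int n}" if "i \<le> n" for i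
      using bound[OF that] that by (simp add: abs_le_iff)
    then show "f \<in> (\<Pi>\<^sub>E i\<in>{0..n}. {- int n..int n})"
      using f by (simp add: Hom_P_def P_verts_def PiE_iff)
  qed
qed (intro finite_PiE; simp)

lemma Hom_P_nonempty: "Hom_P n d \<noteq> {}"
proof -
  let ?f = "restrict (\<lambda>i. int (i mod 2)) (P_verts n)"
  have "\<bar>?f i - ?f j\<bar> = 1" if adj: "P_adj n d i j" for i j
  proof -
    from adj obtain m where "\<bar>int i - int j\<bar> = 2 * int m + 1"
      unfolding P_adj_def by blast
    then have "i mod 2 \<noteq> j mod 2" by presburger
    moreover have "i mod 2 < 2" "j mod 2 < 2" by simp_all
    ultimately have "\<bar>int (i mod 2) - int (j mod 2)\<bar> = 1" by linarith
    then show ?thesis using adj by (simp add: P_adj_def)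
  qed
  then have "?f \<in> Hom_P n d" by (simp add: Hom_P_def P_verts_def)
  then show ?thesis by blast
qed

end

theory Submission imports Defs begin

text \<open>
  Call \<open>i\<close> a jump of \<open>f\<close> if \<open>f (i - 1) \<noteq> f (i + 1)\<close>. A homomorphism is determined by \<open>f 1 = \<plusminus>1\<close> and its
  set of jumps, and the sets that arise are exactly those in which two jumps of opposite
  parity are at distance at least \<open>2d + 1\<close>. Since \<open>f(k+2)\<^sup>2 - f(k)\<^sup>2 = 4 (1 + s f(k))\<close> when \<open>k + 1\<close> is a
  jump of sign \<open>s\<close>, and vanishes otherwise, the increment of the variance is governed by the sum
  \<open>drift k\<close> of \<open>1 + s f(k)\<close> over the jump sets with last element \<open>k + 1\<close>, times the number of ways
  to continue after \<open>k + 1\<close>. Removing the jump at \<open>k - 1\<close>, if there is one, or inserting it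
  changes the sign of \<open>1 + s f(k)\<close>. The jump sets without such a partner are those with an odd last
  gap of exactly \<open>2d + 1\<close>, so that \<open>drift k = drift (k - 2d - 1) + num_ended (k - 2d - 1)\<close>. In
  particular the drift is nonnegative, and it is of order \<open>2\<^sup>-\<^sup>d num_ended k\<close>. The same decomposition
  gives the growth of \<open>num_ended\<close> and shows that each position is a jump with probability bounded below.
\<close>

section \<open>Jump sets and the walks they encode\<close>

definition separated :: "nat \<Rightarrow> nat set \<Rightarrow> bool" where
  "separated d J \<longleftrightarrow> (\<forall>a\<in>J. \<forall>b\<in>J. a < b \<longrightarrow> odd (b - a) \<longrightarrow> 2 * d + 1 \<le> b - a)"

definition jump_sets :: "nat \<Rightarrow> nat \<Rightarrow> nat set set" where
  "jump_sets d N = {J. J \<subseteq> {1..N} \<and> separated d J}"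

text \<open>Indexed by the position just before the last jump, which is where \<open>drift\<close>
  evaluates the walk.\<close>

definition ended :: "nat \<Rightarrow> nat \<Rightarrow> nat set set" where
  "ended d m = {J \<in> jump_sets d (Suc m). Suc m \<in> J}"

text \<open>The increment from \<open>i\<close> to \<open>i + 1\<close> of the walk whose first step
  goes up. It changes sign at every non-jump in \<open>{1..i}\<close>, and the number of these has
  the parity of \<open>i + card (J \<inter> {1..i})\<close>.\<close>

definition step :: "nat set \<Rightarrow> nat \<Rightarrow> int" where
  "step J i = (-1) ^ (i + card (J \<inter> {1..i}))"

definition height :: "nat set \<Rightarrow> nat \<Rightarrow> int" where
  "height J k = (\<Sum>i<k. step J i)"

definition num_ended :: "nat \<Rightarrow> nat \<Rightarrow> nat" where
  "num_ended d m = card (ended d m)"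

definition drift :: "nat \<Rightarrow> nat \<Rightarrow> int" where
  "drift d m = (\<Sum>J\<in>ended d m. 1 + step J m * height J m)"

lemma separatedD:
  "separated d J \<Longrightarrow> a \<in> J \<Longrightarrow> b \<in> J \<Longrightarrow> a < b \<Longrightarrow> odd (b - a) \<Longrightarrow> 2 * d + 1 \<le> b - a"
  by (auto simp: separated_def)

lemma separated_subset: "separated d J \<Longrightarrow> K \<subseteq> J \<Longrightarrow> separated d K"
  by (auto simp: separated_def)

lemma separated_insert:
  assumes "separated d J" "\<And>a. a \<in> J \<Longrightarrow> a < p"
    and "\<And>a. a \<in> J \<Longrightarrow> odd (p - a) \<Longrightarrow> 2 * d + 1 \<le> p - a"
  shows "separated d (insert p J)"
  using assms unfolding separated_def by (metis insertE order_less_asym order_less_irrefl)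

lemma finite_jump_sets [simp]: "finite (jump_sets d N)"
  by (rule finite_subset[of _ "Pow {1..N}"]) (auto simp: jump_sets_def)

lemma finite_ended [simp]: "finite (ended d m)"
  by (simp add: ended_def)

lemma step_0 [simp]: "step J 0 = 1"
  by (simp add: step_def)

lemma step_Suc: "step J (Suc i) = (if Suc i \<in> J then step J i else - step J i)"
proof -
  have "J \<inter> {1..Suc i} = (if Suc i \<in> J then insert (Suc i) (J \<inter> {1..i}) else J \<inter> {1..i})"
    by (auto simp: le_Suc_eq)
  then show ?thesis by (simp add: step_def)
qed

lemma step_square [simp]: "step J i * step J i = 1"
  by (simp add: step_def flip: power_add)

lemma abs_step [simp]: "\<bar>step J i\<bar> = 1"
  by (simp add: step_def power_abs)

lemma height_0 [simp]: "height J 0 = 0"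
  by (simp add: height_def)

lemma height_Suc: "height J (Suc k) = height J k + step J k"
  by (simp add: height_def)

lemma step_cong: "J \<inter> {1..i} = K \<inter> {1..i} \<Longrightarrow> step J i = step K i"
  by (simp add: step_def)

lemma height_cong: "J \<inter> {1..k} = K \<inter> {1..k} \<Longrightarrow> height J k = height K k"
  unfolding height_def
proof (intro sum.cong step_cong refl)
  fix i assume "J \<inter> {1..k} = K \<inter> {1..k}" "i \<in> {..<k}"
  then have "J \<inter> {1..k} \<inter> {1..i} = K \<inter> {1..k} \<inter> {1..i}" "{1..k} \<inter> {1..i} = {1..i}" by auto
  then show "J \<inter> {1..i} = K \<inter> {1..i}" by (simp only: Int_assoc)
qed

lemma height_Suc_Suc:
  "height J (Suc (Suc k)) = height J k + (if Suc k \<in> J then 2 * step J k else 0)"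
  by (simp add: height_Suc step_Suc)

section \<open>Decomposition of jump sets by their last element\<close>

lemma endedD:
  assumes "J \<in> ended d m"
  shows "J \<subseteq> {1..Suc m}" "Suc m \<in> J" "separated d J"
  using assms by (auto simp: ended_def jump_sets_def)

lemma endedI:
  assumes "separated d J" "Suc m \<in> J" "\<And>x. x \<in> J \<Longrightarrow> 1 \<le> x" "\<And>x. x \<in> J \<Longrightarrow> x \<le> Suc m"
  shows "J \<in> ended d m"
  using assms by (auto simp: ended_def jump_sets_def)

text \<open>The new jump has the parity of the old last one, so its odd gaps to earlier jumps are
  odd gaps of \<open>Suc m\<close> widened by 2.\<close>

lemma ended_insert2:
  assumes "J \<in> ended d m"
  shows "insert (m + 3) J \<in> ended d (m + 2)"
proof -
  note J = endedD[OF assms]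
  have "2 * d + 1 \<le> m + 3 - a" if "a \<in> J" "odd (m + 3 - a)" for a
  proof -
    have "a \<le> Suc m" "a \<noteq> Suc m" using J that by auto
    then have "odd (Suc m - a)" "a < Suc m" using that by (auto elim: oddE)
    then show ?thesis using separatedD[OF J(3) that(1) J(2)] by linarith
  qed
  then have "separated d (insert (m + 3) J)"
    using J(1) by (intro separated_insert[OF J(3)]) (auto simp: subset_iff dest!: bspec)
  then show ?thesis using J by (auto simp: ended_def jump_sets_def)
qed

text \<open>The new jump is exactly \<open>2 * d + 1\<close> beyond the old last one, hence far
  enough from every earlier jump.\<close>

lemma ended_insert_odd:
  assumes "J \<in> ended d m"
  shows "insert (m + 2 * d + 2) J \<in> ended d (m + 2 * d + 1)"
proof -
  note J = endedD[OF assms]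
  have "2 * d + 1 \<le> m + 2 * d + 2 - a" if "a \<in> J" for a
    using J(1) that by (auto simp: subset_iff dest!: bspec)
  then have "separated d (insert (m + 2 * d + 2) J)"
    using J(1) by (intro separated_insert[OF J(3)]) (auto simp: subset_iff dest!: bspec)
  then show ?thesis using J by (auto simp: ended_def jump_sets_def)
qed

lemma ended_move:
  assumes "J \<in> ended d m"
  shows "insert (m + 3) (J - {Suc m}) \<in> ended d (m + 2)"
  using ended_insert2[OF assms]
  by (auto simp: ended_def jump_sets_def intro: separated_subset)

text \<open>If \<open>Suc m\<close> is a jump, dropping \<open>m + 3\<close> makes it the last one.
  Otherwise the last jump is moved back from \<open>m + 3\<close> to \<open>Suc m\<close>. This
  fails only if there is a jump at distance exactly \<open>2 * d + 1\<close> from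
  \<open>m + 3\<close>, and that jump is then the last but one.\<close>

lemma ended_cases:
  assumes d: "d \<ge> 1" and J: "J \<in> ended d (m + 2)"
  shows "J \<in> insert (m + 3) ` ended d m \<or> J \<in> (\<lambda>J. insert (m + 3) (J - {Suc m})) ` ended d m
    \<or> (2 * d - 1 \<le> m \<and> J \<in> insert (m + 3) ` ended d (m - (2 * d - 1)))"
proof -
  note E = endedD[OF J]
  have pos: "1 \<le> x" if "x \<in> J" for x using E(1) that by auto
  have m3: "m + 3 \<in> J" using E(2) by (simp add: numeral_3_eq_3)
  have m2: "m + 2 \<notin> J" using separatedD[OF E(3) _ m3, of "m + 2"] d by auto
  have low: "x \<le> Suc m" if "x \<in> J" "x \<noteq> m + 3" for x
    using E(1) that m2 by (cases "x = m + 2") (auto simp: subset_iff dest!: bspec)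
  consider "Suc m \<in> J" | "Suc m \<notin> J" "2 * d - 1 \<le> m" "m + 2 - 2 * d \<in> J"
    | "Suc m \<notin> J" "\<not> (2 * d - 1 \<le> m \<and> m + 2 - 2 * d \<in> J)" by blast
  then show ?thesis
  proof cases
    case 1
    have "J - {m + 3} \<in> ended d m"
      using 1 pos low by (intro endedI separated_subset[OF E(3)]) auto
    moreover have "J = insert (m + 3) (J - {m + 3})" using m3 by auto
    ultimately show ?thesis by blast
  next
    case 2
    define q where "q = m + 2 - 2 * d"
    have q: "q + 2 * d + 1 = m + 3" "q \<in> J" "Suc (m - (2 * d - 1)) = q"
      using 2 d by (auto simp: q_def)
    \<comment> \<open>A jump strictly between \<open>q\<close> and \<open>m + 3\<close> is at odd
      distance from one of them, since they are \<open>2 * d + 1\<close> apart, and that distance is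
      too short.\<close>
    have "x \<le> q" if x: "x \<in> J" "x \<noteq> m + 3" for x
    proof (rule ccontr)
      assume "\<not> x \<le> q"
      then have "q < x" "x < m + 3" using low[OF x] by auto
      moreover have "odd (x - q) \<or> odd (m + 3 - x)"
        using q(1) \<open>q < x\<close> \<open>x < m + 3\<close> by presburger
      ultimately show False
        using separatedD[OF E(3) q(2) x(1)] separatedD[OF E(3) x(1) m3] q(1) by auto
    qed
    then have "J - {m + 3} \<in> ended d (m - (2 * d - 1))"
      using q pos by (intro endedI separated_subset[OF E(3)]) auto
    moreover have "J = insert (m + 3) (J - {m + 3})" using m3 by auto
    ultimately show ?thesis using 2 by blast
  next
    case 3
    define K where "K = insert (Suc m) (J - {m + 3})"
    \<comment> \<open>The gap from \<open>a\<close> to \<open>m + 3\<close> is odd and at least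
      \<open>2 * d + 1\<close>. Equality is excluded by the case and \<open>2 * d + 2\<close> by
      parity, so two units can be given up.\<close>
    have "2 * d + 1 \<le> Suc m - a" if a: "a \<in> J" "a \<noteq> m + 3" "odd (Suc m - a)" for a
    proof -
      have "a < Suc m" using low[OF a(1,2)] a(1) 3(1) by (cases "a = Suc m") auto
      moreover from this have "odd (m + 3 - a)" using a(3) by presburger
      ultimately have "2 * d + 1 \<le> m + 3 - a" using separatedD[OF E(3) a(1) m3] by auto
      moreover have "m + 3 - a \<noteq> 2 * d + 1"
      proof
        assume "m + 3 - a = 2 * d + 1"
        moreover have "a \<ge> 1" using E(1) a(1) by auto
        ultimately have "a = m + 2 - 2 * d" "2 * d - 1 \<le> m" by linarith+
        then show False using 3(2) a(1) by simp
      qed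
      moreover have "m + 3 - a \<noteq> 2 * d + 2" using \<open>odd (m + 3 - a)\<close> by presburger
      ultimately show ?thesis by linarith
    qed
    then have "separated d K"
      unfolding K_def using separated_subset[OF E(3), of "J - {m + 3}"] low 3(1)
      by (intro separated_insert) (auto simp: less_le)
    then have "K \<in> ended d m" using low pos by (intro endedI) (auto simp: K_def)
    moreover have "J = insert (m + 3) (K - {Suc m})" using m3 3(1) by (auto simp: K_def)
    ultimately show ?thesis by blast
  qed
qed

text \<open>The summand is arbitrary so that both the count and the drift can be inserted. The three
  families are told apart by membership of \<open>Suc m\<close> and of \<open>m + 2 - 2 * d\<close>;
  the guard \<open>2 * d - 1 \<le> m\<close> makes the latter a genuine position.\<close>

lemma sum_ended:
  fixes g :: "nat set \<Rightarrow> 'a::comm_monoid_add"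
  assumes d: "d \<ge> 1"
  shows "sum g (ended d (m + 2)) =
    (\<Sum>J\<in>ended d m. g (insert (m + 3) J) + g (insert (m + 3) (J - {Suc m}))) +
    (if 2 * d - 1 \<le> m then \<Sum>J\<in>ended d (m - (2 * d - 1)). g (insert (m + 3) J) else 0)"
proof -
  let ?A = "insert (m + 3) ` ended d m"
  let ?B = "(\<lambda>J. insert (m + 3) (J - {Suc m})) ` ended d m"
  let ?C = "if 2 * d - 1 \<le> m then insert (m + 3) ` ended d (m - (2 * d - 1)) else {}"
  have C: "J \<in> ended d (m + 2) \<and> Suc m \<notin> J \<and> 2 * d - 1 \<le> m \<and> m + 2 - 2 * d \<in> J" if CJ: "J \<in> ?C" for J
  proof -
    have m: "2 * d - 1 \<le> m" using CJ by (auto split: if_splits)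
    then obtain K where K: "K \<in> ended d (m - (2 * d - 1))" "J = insert (m + 3) K"
      using CJ unfolding if_P[OF m] by blast
    have e: "m - (2 * d - 1) + 2 * d + 2 = m + 3" "m - (2 * d - 1) + 2 * d + 1 = m + 2"
      using m d by auto
    have "Suc (m - (2 * d - 1)) = m + 2 - 2 * d" "m + 2 - 2 * d < Suc m"
      using m d by auto
    then have "Suc m \<notin> K" "m + 2 - 2 * d \<in> K" using endedD(1,2)[OF K(1)] by auto
    then show ?thesis using ended_insert_odd[OF K(1), unfolded e] K(2) m by simp
  qed
  have B: "Suc m \<notin> J \<and> \<not> (2 * d - 1 \<le> m \<and> m + 2 - 2 * d \<in> J)" if BJ: "J \<in> ?B" for J
  proof -
    obtain K where K: "K \<in> ended d m" "J = insert (m + 3) (K - {Suc m})" using BJ by blast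
    \<comment> \<open>Such a jump would be at the odd distance \<open>2 * d - 1\<close> from the
      jump \<open>Suc m\<close> of \<open>K\<close>.\<close>
    have "m + 2 - 2 * d \<notin> K" if "2 * d - 1 \<le> m"
    proof
      assume "m + 2 - 2 * d \<in> K"
      moreover have "Suc m - (m + 2 - 2 * d) = 2 * d - 1" "m + 2 - 2 * d < Suc m"
        using that d by auto
      ultimately show False
        using separatedD[OF endedD(3)[OF K(1)] _ endedD(2)[OF K(1)], of "m + 2 - 2 * d"] d by simp
    qed
    then show ?thesis using K by auto
  qed
  have A: "Suc m \<in> J" if "J \<in> ?A" for J
    using that endedD(2) by blast
  have U: "ended d (m + 2) = ?A \<union> ?B \<union> ?C"
  proof
    show "ended d (m + 2) \<subseteq> ?A \<union> ?B \<union> ?C"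
    proof
      fix J assume "J \<in> ended d (m + 2)"
      from ended_cases[OF d this] show "J \<in> ?A \<union> ?B \<union> ?C" by auto
    qed
    show "?A \<union> ?B \<union> ?C \<subseteq> ended d (m + 2)"
      using C ended_insert2 ended_move by blast
  qed
  have AB: "?A \<inter> ?B = {}" and ABC: "(?A \<union> ?B) \<inter> ?C = {}"
    using A B C by blast+
  have notin: "m + 3 \<notin> J" if "J \<in> ended d k" "k \<le> m" for J k
    using endedD(1)[OF that(1)] that(2) by auto
  have injA: "inj_on (insert (m + 3)) (ended d k)" if "k \<le> m" for k
    using notin that by (intro inj_onI) (metis insert_ident)
  have injB: "inj_on (\<lambda>J. insert (m + 3) (J - {Suc m})) (ended d m)"
  proof (rule inj_onI)
    fix J K assume JK: "J \<in> ended d m" "K \<in> ended d m"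
      "insert (m + 3) (J - {Suc m}) = insert (m + 3) (K - {Suc m})"
    then have "J - {Suc m} = K - {Suc m}"
      using notin[of J m] notin[of K m] by (metis DiffE insert_ident order_refl)
    then show "J = K" using JK endedD(2) by (metis insert_Diff)
  qed
  have "sum g (ended d (m + 2)) = sum g ?A + sum g ?B + sum g ?C"
    unfolding U by (subst sum.union_disjoint, simp, simp, rule ABC)
      (subst sum.union_disjoint[OF _ _ AB], auto)
  also have "sum g ?A = (\<Sum>J\<in>ended d m. g (insert (m + 3) J))"
    by (simp add: sum.reindex injA)
  also have "sum g ?B = (\<Sum>J\<in>ended d m. g (insert (m + 3) (J - {Suc m})))"
    by (simp add: sum.reindex injB)
  also have "sum g ?C = (if 2 * d - 1 \<le> m then \<Sum>J\<in>ended d (m - (2 * d - 1)). g (insert (m + 3) J) else 0)"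
    by (simp add: sum.reindex injA)
  finally show ?thesis by (simp add: sum.distrib)
qed

lemma ended_0: "ended d 0 = {{1}}"
  by (auto simp: ended_def jump_sets_def separated_def)

lemma ended_1: "d \<ge> 1 \<Longrightarrow> ended d 1 = {{2}}"
proof -
  assume d: "d \<ge> 1"
  have "J = {2}" if "J \<in> ended d 1" for J
  proof -
    note E = endedD[OF that]
    have two: "2 \<in> J" using E(2) by (simp add: numeral_2_eq_2)
    have one: "1 \<notin> J" using separatedD[OF E(3) _ two, of 1] d by auto
    have "x = 2" if "x \<in> J" for x
    proof -
      have "x \<in> {1..2}" using E(1) that by (auto simp: numeral_2_eq_2)
      moreover have "x \<noteq> 1" using one that by auto
      ultimately show ?thesis by auto
    qed
    then show ?thesis using two by blast
  qed
  moreover have "{2} \<in> ended d 1" by (auto simp: ended_def jump_sets_def separated_def)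
  ultimately show ?thesis by blast
qed

section \<open>Recursions for the count and for the drift\<close>

lemma num_ended_0 [simp]: "num_ended d 0 = 1"
  by (simp add: num_ended_def ended_0)

lemma num_ended_1 [simp]: "d \<ge> 1 \<Longrightarrow> num_ended d (Suc 0) = 1"
  using ended_1[of d] by (simp add: num_ended_def)

lemma num_ended_rec:
  assumes "d \<ge> 1"
  shows "num_ended d (m + 2) = 2 * num_ended d m + (if 2 * d - 1 \<le> m then num_ended d (m - (2 * d - 1)) else 0)"
  unfolding num_ended_def card_eq_sum by (subst sum_ended[OF assms]) (simp add: sum.distrib mult_2)

text \<open>After its last jump the walk oscillates with period 2.\<close>

lemma alternating:
  assumes "J \<in> ended d m"
  shows "step J (Suc m + 2 * t) = step J m" "height J (Suc m + 2 * t) = height J m + step J m"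
proof (induction t)
  case 0
  { case 1 show ?case using endedD(2)[OF assms] by (simp add: step_Suc)
  next case 2 show ?case by (simp add: height_Suc) }
next
  case (Suc t)
  have "Suc (Suc m + 2 * t) \<notin> J" "Suc (Suc (Suc m + 2 * t)) \<notin> J" using endedD(1)[OF assms] by auto
  with Suc show "step J (Suc m + 2 * Suc t) = step J m"
      "height J (Suc m + 2 * Suc t) = height J m + step J m"
    by (auto simp: step_Suc height_Suc)
qed

lemma drift_0 [simp]: "drift d 0 = 1"
  by (simp add: drift_def ended_0)

lemma drift_1 [simp]: "d \<ge> 1 \<Longrightarrow> drift d (Suc 0) = 0"
  using ended_1[of d] by (simp add: drift_def step_Suc height_Suc)

lemma drift_rec:
  assumes "d \<ge> 1"
  shows "drift d (m + 2) =
    (if 2 * d - 1 \<le> m then drift d (m - (2 * d - 1)) + int (num_ended d (m - (2 * d - 1))) else 0)"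
proof -
  define g where "g J = 1 + step J (m + 2) * height J (m + 2)" for J
  \<comment> \<open>\<open>g\<close> looks only at positions up to \<open>m + 2\<close>, so
    inserting \<open>m + 3\<close> does not affect it.\<close>
  have drop: "g (insert (m + 3) J) = g J" for J
    unfolding g_def by (intro arg_cong2[of _ _ _ _ "\<lambda>x y. 1 + x * y"] step_cong height_cong) auto
  \<comment> \<open>With \<open>s\<close> and \<open>h\<close> the step and height at
    \<open>m\<close>, the value is \<open>- (1 + s * h)\<close> if \<open>Suc m\<close> is a jump
    and \<open>1 + s * h\<close> if it is not.\<close>
  have 1: "g (insert (m + 3) J) + g (insert (m + 3) (J - {Suc m})) = 0" if J: "J \<in> ended d m" for J
  proof -
    have J': "Suc m \<in> J" "Suc (Suc m) \<notin> J" using endedD[OF J] by auto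
    have "step (J - {Suc m}) m = step J m" "height (J - {Suc m}) m = height J m"
      by (intro step_cong height_cong; auto)+
    then show ?thesis unfolding drop using J'
      by (simp add: g_def height_Suc_Suc step_Suc algebra_simps)
  qed
  \<comment> \<open>The position \<open>m + 2\<close> is an odd number of steps past
    \<open>k\<close>, where the step is that at \<open>k\<close> and the height has grown by it; the
    square of the step gives the extra 1.\<close>
  have 2: "g (insert (m + 3) J) = (1 + step J k * height J k) + 1"
    if "J \<in> ended d k" "k = m - (2 * d - 1)" "2 * d - 1 \<le> m" for J k
  proof -
    have "m + 2 = Suc k + 2 * d" using that assms by auto
    then have "g J = (1 + step J k * height J k) + 1"
      unfolding g_def by (simp only: alternating[OF that(1)]) (simp add: algebra_simps)
    then show ?thesis unfolding drop .
  qed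
  show ?thesis
    unfolding drift_def num_ended_def by (subst sum_ended[OF assms], fold g_def) (simp add: 1 2 sum.distrib)
qed


section \<open>Growth of the number of ended jump sets\<close>

lemma num_ended_double: "d \<ge> 1 \<Longrightarrow> 2 * num_ended d m \<le> num_ended d (m + 2)"
  by (simp add: num_ended_rec del: add_2_eq_Suc')

text \<open>The recursions at two consecutive positions are compared term by term.\<close>

lemma num_ended_le_Suc:
  assumes d: "d \<ge> 1"
  shows "num_ended d m \<le> num_ended d (Suc m)"
proof (induction m rule: less_induct)
  case (less m)
  consider "m = 0" | "m = 1" | m' where "m = m' + 2"
    by (metis One_nat_def Suc_pred add.commute add_2_eq_Suc not_gr_zero)
  then show ?case
  proof cases
    case 1
    then show ?thesis using d by simp
  next
    case 2
    then show ?thesis using num_ended_double[OF d, of 0] d by (simp add: numeral_2_eq_2)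
  next
    case 3
    have "num_ended d m' \<le> num_ended d (Suc m')" using less 3 by simp
    moreover have "num_ended d (m' - (2 * d - 1)) \<le> num_ended d (Suc m' - (2 * d - 1))" if "2 * d - 1 \<le> m'"
      using less[of "m' - (2 * d - 1)"] 3 that by (simp add: Suc_diff_le)
    ultimately show ?thesis
      using num_ended_rec[OF d, of m'] num_ended_rec[OF d, of "Suc m'"] 3
      by (cases "2 * d - 1 \<le> m'") (simp_all del: One_nat_def)
  qed
qed

lemma num_ended_mono: "d \<ge> 1 \<Longrightarrow> a \<le> b \<Longrightarrow> num_ended d a \<le> num_ended d b"
  by (rule lift_Suc_mono_le[of "num_ended d"]) (simp_all add: num_ended_le_Suc)

lemma num_ended_exp_le:
  assumes "d \<ge> 1"
  shows "2 ^ j * num_ended d m \<le> num_ended d (m + 2 * j)"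
proof (induction j)
  case (Suc j)
  then have "2 ^ Suc j * num_ended d m \<le> 2 * num_ended d (m + 2 * j)" by simp
  also have "\<dots> \<le> num_ended d (m + 2 * j + 2)" by (rule num_ended_double[OF assms])
  finally show ?case by simp
qed simp

text \<open>The extra term of the recursion lies \<open>2 * d - 1\<close> positions before
  \<open>m\<close>, so \<open>d - 1\<close> doublings and monotonicity make it small against
  \<open>num_ended d m\<close>.\<close>

lemma num_ended_le_double:
  assumes d: "d \<ge> 1"
  shows "real (num_ended d (m + 2)) \<le> 2 * (1 + 1 / 2 ^ d) * real (num_ended d m)"
proof -
  have "2 ^ d * real (num_ended d (m - (2 * d - 1))) \<le> 2 * real (num_ended d m)" if m: "2 * d - 1 \<le> m"
  proof -
    have "2 ^ (d - 1) * num_ended d (m - (2 * d - 1)) \<le> num_ended d (m - (2 * d - 1) + 2 * (d - 1))"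
      by (rule num_ended_exp_le[OF d])
    also have "\<dots> \<le> num_ended d m" using m d by (intro num_ended_mono) auto
    finally have "2 * (2 ^ (d - 1) * num_ended d (m - (2 * d - 1))) \<le> 2 * num_ended d m" by simp
    moreover have "(2::nat) ^ d = 2 * 2 ^ (d - 1)" using d by (cases d) auto
    ultimately have "2 ^ d * num_ended d (m - (2 * d - 1)) \<le> 2 * num_ended d m" by simp
    then have "real (2 ^ d * num_ended d (m - (2 * d - 1))) \<le> real (2 * num_ended d m)" by (rule of_nat_mono)
    then show ?thesis by simp
  qed
  then show ?thesis by (simp add: num_ended_rec[OF d] field_simps del: add_2_eq_Suc')
qed

text \<open>Keeps the error accumulated over \<open>d\<close> double steps within a factor
  2.\<close>

lemma power_one_plus_le_2:
  assumes d: "d \<ge> 1"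
  shows "(1 + 1 / 2 ^ d :: real) ^ d \<le> 2"
proof -
  have "2 * d \<le> 2 ^ d" using d by (induction d rule: dec_induct) auto
  then have "real (2 * d) \<le> real (2 ^ d)" by (rule of_nat_mono)
  then have "real d * (1 / 2 ^ d) \<le> 1 / 2" by (simp add: field_simps)
  then have "exp (real d * (1 / 2 ^ d)) \<le> exp (1 / 2 :: real)" by (simp only: exp_le_cancel_iff)
  moreover have "(1 + 1 / 2 ^ d :: real) ^ d \<le> exp (1 / 2 ^ d) ^ d"
    by (intro power_mono exp_ge_add_one_self) simp
  then have "(1 + 1 / 2 ^ d :: real) ^ d \<le> exp (real d * (1 / 2 ^ d))"
    by (simp only: exp_of_nat_mult)
  ultimately show ?thesis using exp_half_le2 by linarith
qed

lemma num_ended_le_exp: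
  assumes d: "d \<ge> 1" and j: "j \<le> d"
  shows "num_ended d (m + 2 * j) \<le> 2 ^ (j + 1) * num_ended d m"
proof -
  have "real (num_ended d (m + 2 * j)) \<le> (2 * (1 + 1 / 2 ^ d)) ^ j * real (num_ended d m)"
  proof (induction j)
    case (Suc j)
    have "real (num_ended d (m + 2 * j + 2)) \<le> 2 * (1 + 1 / 2 ^ d) * real (num_ended d (m + 2 * j))"
      by (rule num_ended_le_double[OF d])
    also have "\<dots> \<le> 2 * (1 + 1 / 2 ^ d) * ((2 * (1 + 1 / 2 ^ d)) ^ j * real (num_ended d m))"
      by (intro mult_left_mono Suc) auto
    finally show ?case by (simp add: mult.assoc)
  qed simp
  also have "(2 * (1 + 1 / 2 ^ d)) ^ j * real (num_ended d m) \<le> (2 ^ j * (1 + 1 / 2 ^ d) ^ d) * real (num_ended d m)"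
    unfolding power_mult_distrib by (intro mult_right_mono mult_left_mono power_increasing[OF j]) auto
  also have "\<dots> \<le> (2 ^ j * 2) * real (num_ended d m)"
    by (intro mult_right_mono mult_left_mono power_one_plus_le_2[OF d]) auto
  finally have "real (num_ended d (m + 2 * j)) \<le> real (2 ^ (j + 1) * num_ended d m)" by (simp add: mult.commute)
  then show ?thesis by (simp only: of_nat_le_iff)
qed

text \<open>For \<open>b \<ge> 2 * d + 1\<close> both sides obey the same linear recursion in
  \<open>b\<close>, so only \<open>b \<le> 2 * d\<close> needs an estimate. There
  \<open>num_ended_le_exp\<close> costs a factor 2, and rounding an odd \<open>b\<close> up to an
  even number costs another.\<close>

lemma num_ended_submult:
  assumes d: "d \<ge> 1"
  shows "num_ended d (a + b) \<le> 4 * num_ended d a * num_ended d b"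
proof (induction b rule: less_induct)
  case (less b)
  show ?case
  proof (cases "2 * d + 1 \<le> b")
    case True
    define b' where "b' = b - 2"
    have b: "b = b' + 2" "2 * d - 1 \<le> b'" using True d by (auto simp: b'_def)
    have "num_ended d (a + b') \<le> 4 * num_ended d a * num_ended d b'" using less[of b'] b by simp
    moreover have "num_ended d (a + (b' - (2 * d - 1))) \<le> 4 * num_ended d a * num_ended d (b' - (2 * d - 1))"
      using less[of "b' - (2 * d - 1)"] b by simp
    moreover have "num_ended d (a + b) = 2 * num_ended d (a + b') + num_ended d (a + (b' - (2 * d - 1)))"
      using num_ended_rec[OF d, of "a + b'"] b by (simp add: add.assoc del: add_2_eq_Suc')
    ultimately have "num_ended d (a + b) \<le> 2 * (4 * num_ended d a * num_ended d b') + 4 * num_ended d a * num_ended d (b' - (2 * d - 1))"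
      by linarith
    also have "\<dots> = 4 * num_ended d a * (2 * num_ended d b' + num_ended d (b' - (2 * d - 1)))"
      by (simp only: distrib_left ac_simps)
    also have "2 * num_ended d b' + num_ended d (b' - (2 * d - 1)) = num_ended d b"
      using num_ended_rec[OF d, of b'] b by (simp del: add_2_eq_Suc')
    finally show ?thesis .
  next
    case False
    show ?thesis
    proof (cases "even b")
      case True
      then obtain j where j: "b = 2 * j" by blast
      then have "num_ended d (a + b) \<le> 2 ^ j * (2 * num_ended d a)" using num_ended_le_exp[OF d, of j a] False by simp
      moreover have "2 ^ j \<le> num_ended d b" using num_ended_exp_le[OF d, of j 0] j by simp
      then have "2 ^ j * (2 * num_ended d a) \<le> num_ended d b * (2 * num_ended d a)" by (rule mult_le_mono1)
      ultimately have "num_ended d (a + b) \<le> num_ended d b * (2 * num_ended d a)" by (rule order_trans)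
      then show ?thesis by (simp add: algebra_simps)
    next
      case odd: False
      then obtain j where j: "b = 2 * j + 1" by (blast elim: oddE)
      have "num_ended d (a + b) \<le> num_ended d (a + 2 * (j + 1))" using j by (intro num_ended_mono[OF d]) simp
      also have "\<dots> \<le> 2 ^ (j + 1 + 1) * num_ended d a" using j False by (intro num_ended_le_exp[OF d]) simp
      finally have "num_ended d (a + b) \<le> 2 ^ j * (4 * num_ended d a)" by simp
      moreover have "2 ^ j \<le> num_ended d b" using num_ended_exp_le[OF d, of j 1] j d by (simp add: add.commute)
      then have "2 ^ j * (4 * num_ended d a) \<le> num_ended d b * (4 * num_ended d a)" by (rule mult_le_mono1)
      ultimately have "num_ended d (a + b) \<le> num_ended d b * (4 * num_ended d a)" by (rule order_trans)
      then show ?thesis by (simp add: algebra_simps)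
    qed
  qed
qed

section \<open>The total number of jump sets\<close>

lemma card_jump_sets_Suc: "card (jump_sets d (Suc N)) = card (jump_sets d N) + num_ended d N"
proof -
  have "jump_sets d (Suc N) = jump_sets d N \<union> ended d N"
    by (auto simp: ended_def jump_sets_def subset_iff le_Suc_eq)
  moreover have "jump_sets d N \<inter> ended d N = {}" by (auto simp: ended_def jump_sets_def)
  ultimately show ?thesis by (simp add: num_ended_def card_Un_disjoint)
qed

lemma card_jump_sets_0: "card (jump_sets d 0) = 1"
proof -
  have "jump_sets d 0 = {{}}" by (auto simp: jump_sets_def separated_def)
  then show ?thesis by simp
qed

text \<open>The total is a sum of values of \<open>num_ended\<close>, which at least double every
  two positions, so the last two dominate. The induction keeps both of them because the doubling
  compares only positions of equal parity.\<close>

lemma card_jump_sets_le: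
  assumes d: "d \<ge> 1"
  shows "card (jump_sets d (Suc m)) \<le> 4 * num_ended d m"
proof -
  have "card (jump_sets d (Suc (Suc m))) \<le> 2 * (num_ended d (Suc m) + num_ended d m)" for m
  proof (induction m rule: induct_nat_012)
    case 0
    then show ?case using d by (simp add: card_jump_sets_Suc card_jump_sets_0)
  next
    case 1
    then show ?case using d num_ended_double[OF d, of 0] by (simp add: card_jump_sets_Suc card_jump_sets_0 numeral_2_eq_2)
  next
    case (ge2 m)
    then show ?case
      using num_ended_double[OF d, of m] num_ended_double[OF d, of "Suc m"] by (simp add: card_jump_sets_Suc)
  qed
  note * = this
  show ?thesis
  proof (cases m)
    case 0
    then show ?thesis by (simp add: card_jump_sets_Suc card_jump_sets_0)
  next
    case (Suc m')
    then show ?thesis using *[of m'] num_ended_le_Suc[OF d, of m'] by simp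
  qed
qed

section \<open>Splitting jump sets at a prescribed jump\<close>

lemma separated_reflect:
  assumes "separated d J" "J \<subseteq> {..N}"
  shows "separated d ((\<lambda>x. N - x) ` J)"
  unfolding separated_def
proof (clarify)
  fix a b assume ab: "a \<in> J" "b \<in> J" "N - a < N - b" "odd (N - b - (N - a))"
  have "N - b - (N - a) = a - b" "b < a" using ab assms(2) by auto
  then show "2 * d + 1 \<le> N - b - (N - a)" using separatedD[OF assms(1) ab(2,1)] ab(4) by auto
qed

text \<open>A set is cut at its jump \<open>Suc k\<close>. The left part ends there, and so does the
  right part after the reflection \<open>?r\<close>. The parts can be chosen independently, and
  \<open>g\<close> sees only the left one.\<close>

lemma sum_jump_sets_through:
  fixes g :: "nat set \<Rightarrow> 'a::comm_semiring_1"
  assumes k: "Suc k \<le> N" and g: "\<And>J. g (J \<inter> {..Suc k}) = g J"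
  shows "(\<Sum>J | J \<in> jump_sets d N \<and> Suc k \<in> J. g J) = sum g (ended d k) * of_nat (num_ended d (N - Suc k))"
proof -
  let ?p = "Suc k"
  let ?r = "\<lambda>x. Suc N - x"
  have rr: "?r ` ?r ` B = B" if "B \<subseteq> {..Suc N}" for B
    using that by (force simp: image_image)
  have "(\<Sum>J | J \<in> jump_sets d N \<and> ?p \<in> J. g J) = (\<Sum>(A, B)\<in>ended d k \<times> ended d (N - ?p). g A)"
  proof (rule sum.reindex_bij_witness[where j = "\<lambda>J. (J \<inter> {..?p}, ?r ` (J \<inter> {?p..}))"
        and i = "\<lambda>(A, B). A \<union> ?r ` B"])
    fix J assume J: "J \<in> {J. J \<in> jump_sets d N \<and> ?p \<in> J}"
    then have sub: "J \<subseteq> {1..N}" and sep: "separated d J" and p: "?p \<in> J" by (auto simp: jump_sets_def)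
    have "?r ` ?r ` (J \<inter> {?p..}) = J \<inter> {?p..}" using sub by (intro rr) auto
    then show "(case (J \<inter> {..?p}, ?r ` (J \<inter> {?p..})) of (A, B) \<Rightarrow> A \<union> ?r ` B) = J"
      by auto
    have 1: "J \<inter> {..?p} \<in> ended d k"
      using sub p by (intro endedI separated_subset[OF sep]) auto
    have 2: "?r ` (J \<inter> {?p..}) \<in> ended d (N - ?p)"
    proof (rule endedI)
      show "separated d (?r ` (J \<inter> {?p..}))"
        using sub by (intro separated_reflect separated_subset[OF sep]) auto
      have "Suc (N - ?p) = ?r ?p" using k by simp
      then show "Suc (N - ?p) \<in> ?r ` (J \<inter> {?p..})" using p by (metis IntI atLeast_iff image_eqI order_refl)
    qed (use sub in auto)
    from 1 2 show "(J \<inter> {..?p}, ?r ` (J \<inter> {?p..})) \<in> ended d k \<times> ended d (N - ?p)" by simp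
    show "(case (J \<inter> {..?p}, ?r ` (J \<inter> {?p..})) of (A, B) \<Rightarrow> g A) = g J"
      using g by simp
  next
    fix AB assume "AB \<in> ended d k \<times> ended d (N - ?p)"
    then obtain A B where AB: "AB = (A, B)" and A: "A \<in> ended d k" and B: "B \<in> ended d (N - ?p)"
      by blast
    note EA = endedD[OF A] and EB = endedD[OF B]
    have B_sub: "B \<subseteq> {..Suc N}" "B \<subseteq> {1..Suc (N - ?p)}" using EB(1) k by (force, simp)
    have sepB: "separated d (?r ` B)" by (rule separated_reflect[OF EB(3) B_sub(1)])
    have pB: "?p \<in> ?r ` B" using EB(2) k by (intro image_eqI[of _ _ "Suc (N - ?p)"]) auto
    have A_le: "1 \<le> x" "x \<le> ?p" if "x \<in> A" for x using EA(1) that by auto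
    have B_ge: "?p \<le> x" "x \<le> N" if x: "x \<in> ?r ` B" for x
    proof -
      obtain y where "y \<in> B" "x = ?r y" using x by blast
      moreover from this have "1 \<le> y" "y \<le> Suc (N - ?p)" using B_sub(2) by auto
      ultimately show "?p \<le> x" "x \<le> N" using k by auto
    qed
    \<comment> \<open>An odd gap across \<open>?p\<close> is the sum of an odd and an even gap to
      \<open>?p\<close>, and the odd one alone is long enough.\<close>
    have cross: "2 * d + 1 \<le> b - a" if "a \<in> A" "b \<in> ?r ` B" "a < b" "odd (b - a)" for a b
    proof (cases "odd (?p - a)")
      case True
      then have "a < ?p" by (metis diff_is_0_eq' even_zero not_less)
      then have "2 * d + 1 \<le> ?p - a" using separatedD[OF EA(3) that(1) EA(2) _ True] by simp
      also have "\<dots> \<le> b - a" using B_ge(1)[OF that(2)] by simp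
      finally show ?thesis .
    next
      case False
      then have odd: "odd (b - ?p)" using that(3,4) A_le(2)[OF that(1)] B_ge(1)[OF that(2)] by presburger
      then have "?p < b" by (metis diff_is_0_eq' even_zero not_less)
      then have "2 * d + 1 \<le> b - ?p" using separatedD[OF sepB pB that(2) _ odd] by simp
      also have "\<dots> \<le> b - a" using A_le(2)[OF that(1)] by simp
      finally show ?thesis .
    qed
    have nocross: "\<not> b < a" if "a \<in> A" "b \<in> ?r ` B" for a b
      using A_le(2)[OF that(1)] B_ge(1)[OF that(2)] by simp
    have sep: "separated d (A \<union> ?r ` B)"
      unfolding separated_def
    proof (intro ballI impI)
      fix a b assume "a \<in> A \<union> ?r ` B" "b \<in> A \<union> ?r ` B" "a < b" "odd (b - a)"
      then show "2 * d + 1 \<le> b - a"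
        using separatedD[OF EA(3)] separatedD[OF sepB] cross nocross by blast
    qed
    have sub: "A \<union> ?r ` B \<subseteq> {1..N}" using A_le B_ge k by fastforce
    have "(A \<union> ?r ` B) \<inter> {..?p} = A"
      using A_le(2) B_ge(1) EA(2) by (force intro: antisym)
    moreover have "(A \<union> ?r ` B) \<inter> {?p..} = ?r ` B"
    proof (intro equalityI subsetI)
      fix x assume x: "x \<in> (A \<union> ?r ` B) \<inter> {?p..}"
      then show "x \<in> ?r ` B" using A_le(2)[of x] pB by (cases "x = ?p") auto
    next
      fix x assume "x \<in> ?r ` B"
      then show "x \<in> (A \<union> ?r ` B) \<inter> {?p..}" using B_ge(1) by blast
    qed
    ultimately show "(\<lambda>J. (J \<inter> {..?p}, ?r ` (J \<inter> {?p..}))) (case AB of (A, B) \<Rightarrow> A \<union> ?r ` B) = AB"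
      using rr[OF B_sub(1)] AB by simp
    show "(case AB of (A, B) \<Rightarrow> A \<union> ?r ` B) \<in> {J. J \<in> jump_sets d N \<and> ?p \<in> J}"
      using sep sub AB EA(2) by (simp add: jump_sets_def)
  qed
  also have "\<dots> = sum g (ended d k) * of_nat (num_ended d (N - ?p))"
    by (simp add: num_ended_def sum.cartesian_product[symmetric] sum_distrib_right mult.commute)
  finally show ?thesis .
qed


section \<open>Bounds for the drift\<close>

lemma drift_ge_0:
  assumes d: "d \<ge> 1"
  shows "drift d k \<ge> 0"
proof (induction k rule: less_induct)
  case (less k)
  consider "k = 0" | "k = 1" | m where "k = m + 2"
    by (metis One_nat_def Suc_pred add.commute add_2_eq_Suc not_gr_zero)
  then show ?case
  proof cases
    case 3
    then show ?thesis using less[of "m - (2 * d - 1)"] drift_rec[OF d, of m] by simp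
  qed (use d in auto)
qed

lemma num_ended_le_drift:
  assumes d: "d \<ge> 1"
  shows "int (num_ended d k) \<le> drift d (k + (2 * d + 1))"
proof -
  have "k + (2 * d + 1) = (k + (2 * d - 1)) + 2" using d by simp
  then have "drift d (k + (2 * d + 1)) = drift d k + int (num_ended d k)"
    by (simp only: drift_rec[OF d] le_add2 if_True add_diff_cancel_right')
  then show ?thesis using drift_ge_0[OF d, of k] by simp
qed

text \<open>The recursion leads back to \<open>q = k - (2 * d + 1)\<close>, and
  \<open>num_ended\<close> grows at least by the factor \<open>2 ^ d\<close> from there to
  \<open>k\<close>. The 3 is 1 for the \<open>num_ended\<close> term and 2 for
  \<open>drift d q\<close>. At \<open>k = 0\<close> drift and count are both 1, so the bound fails
  there for \<open>d \<ge> 2\<close>.\<close>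

lemma drift_le:
  assumes d: "d \<ge> 1" and k: "k \<ge> 1"
  shows "2 ^ d * drift d k \<le> 3 * int (num_ended d k)"
  using k
proof (induction k rule: less_induct)
  case (less k)
  consider "k = 1" | m where "k = m + 2" "\<not> 2 * d - 1 \<le> m" | m where "k = m + 2" "2 * d - 1 \<le> m"
    using less(2) by (metis One_nat_def Suc_pred add.commute add_2_eq_Suc not_gr_zero not_one_le_zero)
  then show ?case
  proof cases
    case 1
    then show ?thesis using d by simp
  next
    case 2
    then show ?thesis by (simp add: drift_rec[OF d] del: add_2_eq_Suc')
  next
    case 3
    define q where "q = m - (2 * d - 1)"
    have q: "k = q + 2 * d + 1" using 3 d by (simp add: q_def)
    \<comment> \<open>The induction hypothesis does not reach \<open>q = 0\<close>, where both
      quantities are 1.\<close>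
    have "drift d q \<le> 2 * int (num_ended d q)"
    proof (cases "q = 0")
      case False
      have "2 * drift d q \<le> 2 ^ d * drift d q"
        using power_increasing[OF d, of "2::int"] drift_ge_0[OF d] by (intro mult_right_mono) auto
      also have "\<dots> \<le> 3 * int (num_ended d q)" using False q by (intro less(1)) auto
      finally show ?thesis by simp
    qed simp
    then have "drift d k \<le> 3 * int (num_ended d q)"
      using drift_rec[OF d, of m] 3 by (simp add: q_def del: add_2_eq_Suc')
    then have "2 ^ d * drift d k \<le> 2 ^ d * (3 * int (num_ended d q))" by (intro mult_left_mono) auto
    moreover have "2 ^ d * num_ended d q \<le> num_ended d (q + 2 * d)" by (rule num_ended_exp_le[OF d])
    then have "2 ^ d * num_ended d q \<le> num_ended d k" using num_ended_mono[OF d, of "q + 2 * d" k] q by simp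
    then have "int (2 ^ d * num_ended d q) \<le> int (num_ended d k)" by (simp only: of_nat_le_iff)
    then have "2 ^ d * (3 * int (num_ended d q)) \<le> 3 * int (num_ended d k)" by simp
    ultimately show ?thesis by (rule order_trans)
  qed
qed

section \<open>Second moments of the walk, not divided by the number of jump sets\<close>

definition square_sum :: "nat \<Rightarrow> nat \<Rightarrow> nat \<Rightarrow> int" where
  "square_sum d N k = (\<Sum>J\<in>jump_sets d N. height J k ^ 2)"

lemma square_sum_0 [simp]: "square_sum d N 0 = 0"
  by (simp add: square_sum_def)

lemma square_sum_1 [simp]: "square_sum d N (Suc 0) = int (card (jump_sets d N))"
  by (simp add: square_sum_def height_Suc)

lemma square_sum_rec:
  assumes k: "Suc k \<le> N"
  shows "square_sum d N (k + 2) = square_sum d N k + 4 * (drift d k * int (num_ended d (N - Suc k)))"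
proof -
  let ?g = "\<lambda>J. 1 + step J k * height J k"
  have "height J (k + 2) ^ 2 = height J k ^ 2 + (if Suc k \<in> J then 4 * ?g J else 0)" for J
    using step_square[of J k] by (simp add: height_Suc_Suc power2_eq_square algebra_simps)
  then have "square_sum d N (k + 2) = square_sum d N k + (\<Sum>J\<in>jump_sets d N. if Suc k \<in> J then 4 * ?g J else 0)"
    by (simp add: square_sum_def sum.distrib del: add_2_eq_Suc')
  also have "(\<Sum>J\<in>jump_sets d N. if Suc k \<in> J then 4 * ?g J else 0)
      = 4 * (\<Sum>J | J \<in> jump_sets d N \<and> Suc k \<in> J. ?g J)"
    by (simp add: sum.inter_filter[symmetric] sum_distrib_left)
  also have "(\<Sum>J | J \<in> jump_sets d N \<and> Suc k \<in> J. ?g J) = sum ?g (ended d k) * int (num_ended d (N - Suc k))"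
    by (intro sum_jump_sets_through[OF k] arg_cong2[of _ _ _ _ "\<lambda>x y. 1 + x * y"] step_cong height_cong) auto
  finally show ?thesis by (simp add: drift_def)
qed

text \<open>The product counts the jump sets that contain \<open>Suc k\<close>.\<close>

lemma num_ended_mult_le_card_jump_sets:
  assumes "Suc k \<le> N"
  shows "num_ended d k * num_ended d (N - Suc k) \<le> card (jump_sets d N)"
proof -
  have "num_ended d k * num_ended d (N - Suc k) = card {J. J \<in> jump_sets d N \<and> Suc k \<in> J}"
    using sum_jump_sets_through[OF assms, of "\<lambda>_. 1::nat" d] by (simp add: num_ended_def)
  also have "\<dots> \<le> card (jump_sets d N)" by (intro card_mono) auto
  finally show ?thesis .
qed

lemma square_sum_le_square_sum:
  assumes "d \<ge> 1" "Suc k \<le> N"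
  shows "square_sum d N k \<le> square_sum d N (k + 2)"
  using square_sum_rec[OF assms(2), of d] drift_ge_0[OF assms(1), of k] by simp

text \<open>Second moments grow along each parity class, so positions 1 and 2 suffice. At 1 every
  square is 1. At 2 the square is 4 or 0, and at least a quarter of the jump sets contain 1.\<close>

lemma square_sum_ge:
  assumes d: "d \<ge> 1"
  shows "Suc k \<le> Suc N \<Longrightarrow> int (card (jump_sets d N)) \<le> square_sum d N (Suc k)"
proof (induction k rule: induct_nat_012)
  case 0
  then show ?case by simp
next
  case 1
  then obtain N' where N: "N = Suc N'" by (cases N) auto
  have "card (jump_sets d N) \<le> 4 * num_ended d N'" unfolding N by (rule card_jump_sets_le[OF d])
  moreover have "square_sum d N 2 = 4 * int (num_ended d N')" using square_sum_rec[of 0 N d] N by (simp add: numeral_2_eq_2)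
  ultimately show ?case by (simp add: numeral_2_eq_2)
next
  case (ge2 k)
  then show ?case using square_sum_le_square_sum[OF d, of "Suc k" N] by simp
qed

text \<open>Relative to the number of jump sets, a double step from \<open>m \<ge> 1\<close> adds at
  most \<open>12 / 2 ^ d\<close>, that is \<open>6 / 2 ^ d\<close> per position. The double step
  from 0 escapes \<open>drift_le\<close> and may add 4, whence the additive constant.\<close>

lemma square_sum_le:
  assumes d: "d \<ge> 1"
  shows "k \<le> Suc N \<Longrightarrow> 2 ^ d * square_sum d N k \<le> (4 * 2 ^ d + 6 * int k) * int (card (jump_sets d N))"
proof (induction k rule: less_induct)
  case (less k)
  let ?Z = "int (card (jump_sets d N))"
  consider "k = 0" | "k = 1" | "k = 2" | m where "k = m + 2" "m \<ge> 1"
  proof -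
    have "k = 0 \<or> k = 1 \<or> k = 2 \<or> (\<exists>m. k = m + 2 \<and> m \<ge> 1)" by presburger
    then show thesis using that by blast
  qed
  then show ?case
  proof cases
    case 1
    then show ?thesis by simp
  next
    case 2
    then show ?thesis by (simp add: algebra_simps)
  next
    case 3
    have "square_sum d N 2 = 4 * int (num_ended d (N - 1))" using square_sum_rec[of 0 N d] 3 less(2) by (simp add: numeral_2_eq_2)
    also have "\<dots> \<le> 4 * ?Z" using num_ended_mult_le_card_jump_sets[of 0 N d] 3 less(2) by simp
    finally have "2 ^ d * square_sum d N 2 \<le> 2 ^ d * (4 * ?Z)" by (intro mult_left_mono) auto
    also have "\<dots> \<le> (4 * 2 ^ d + 6 * int k) * ?Z" by (simp add: algebra_simps)
    finally show ?thesis using 3 by simp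
  next
    case 4
    have m: "Suc m \<le> N" using 4 less(2) by simp
    have "2 ^ d * square_sum d N k = 2 ^ d * square_sum d N m + 4 * ((2 ^ d * drift d m) * int (num_ended d (N - Suc m)))"
      using square_sum_rec[OF m, of d] 4 by (simp add: algebra_simps del: add_2_eq_Suc')
    also have "\<dots> \<le> (4 * 2 ^ d + 6 * int m) * ?Z + 4 * ((3 * int (num_ended d m)) * int (num_ended d (N - Suc m)))"
      using less(1)[of m] 4 m drift_le[OF d 4(2)] by (intro add_mono mult_left_mono mult_right_mono) auto
    also have "\<dots> = (4 * 2 ^ d + 6 * int m) * ?Z + 12 * int (num_ended d m * num_ended d (N - Suc m))" by simp
    also have "int (num_ended d m * num_ended d (N - Suc m)) \<le> ?Z"
      using num_ended_mult_le_card_jump_sets[OF m, of d] by (simp only: of_nat_le_iff)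
    finally show ?thesis using 4 by (simp add: algebra_simps)
  qed
qed

text \<open>The positions are cut into \<open>a\<close>, a stretch of length
  \<open>2 * d + 1\<close> and \<open>b\<close>. The factors are 4 from
  \<open>card_jump_sets_le\<close>, 4 from each of two uses of \<open>num_ended_submult\<close>, and
  \<open>2 ^ (d + 1)\<close> for the middle stretch; the 4 in \<open>square_sum_rec\<close> reduces
  128 to 32.\<close>

lemma square_sum_growth:
  assumes d: "d \<ge> 1" and k: "2 * d + 1 \<le> k" "Suc k \<le> N"
  shows "int (card (jump_sets d N)) \<le> 32 * 2 ^ d * (square_sum d N (k + 2) - square_sum d N k)"
proof -
  define a where "a = k - (2 * d + 1)"
  define b where "b = N - Suc k"
  have k': "k = a + (2 * d + 1)" and N: "N = Suc (a + ((1 + 2 * d) + b))" using k by (auto simp: a_def b_def)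
  have "card (jump_sets d N) \<le> 4 * num_ended d (a + ((1 + 2 * d) + b))" unfolding N by (rule card_jump_sets_le[OF d])
  also have "\<dots> \<le> 4 * (4 * num_ended d a * (4 * num_ended d (1 + 2 * d) * num_ended d b))"
    by (intro mult_left_mono order_trans[OF num_ended_submult[OF d]] mult_mono order_refl) auto
  also have "\<dots> \<le> 4 * (4 * num_ended d a * (4 * (2 ^ (d + 1) * num_ended d 1) * num_ended d b))"
    by (intro mult_left_mono mult_right_mono num_ended_le_exp d) auto
  finally have "card (jump_sets d N) \<le> 128 * 2 ^ d * (num_ended d a * num_ended d b)" using d by (simp add: algebra_simps)
  then have "int (card (jump_sets d N)) \<le> int (128 * 2 ^ d * (num_ended d a * num_ended d b))" by (simp only: of_nat_le_iff)
  also have "\<dots> = 128 * 2 ^ d * (int (num_ended d a) * int (num_ended d b))" by simp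
  also have "\<dots> \<le> 128 * 2 ^ d * (drift d k * int (num_ended d b))"
    using num_ended_le_drift[OF d, of a] k' by (intro mult_left_mono mult_right_mono) auto
  also have "\<dots> = 32 * 2 ^ d * (square_sum d N (k + 2) - square_sum d N k)"
    using square_sum_rec[OF k(2), of d] by (simp add: b_def)
  finally show ?thesis .
qed

lemma square_sum_linear:
  assumes d: "d \<ge> 1" and r: "2 * d + 1 \<le> r"
  shows "r + 2 * t \<le> Suc N \<Longrightarrow> int t * int (card (jump_sets d N)) \<le> 32 * 2 ^ d * square_sum d N (r + 2 * t)"
proof (induction t)
  case 0
  then show ?case by (simp add: square_sum_def sum_nonneg)
next
  case (Suc t)
  have "int (Suc t) * int (card (jump_sets d N)) = int t * int (card (jump_sets d N)) + int (card (jump_sets d N))"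
    by (simp add: algebra_simps)
  also have "\<dots> \<le> 32 * 2 ^ d * square_sum d N (r + 2 * t) + 32 * 2 ^ d * (square_sum d N (r + 2 * t + 2) - square_sum d N (r + 2 * t))"
    using Suc r by (intro add_mono[OF _ square_sum_growth[OF d]]) auto
  finally show ?case by (simp add: algebra_simps)
qed

text \<open>For \<open>k \<ge> 4 * d + 4\<close> at least \<open>k / 4\<close> double steps start
  beyond \<open>2 * d\<close>, each with the gain of \<open>square_sum_growth\<close>. For smaller
  \<open>k\<close> the factor \<open>128 * 2 ^ d\<close> exceeds \<open>k\<close>, and
  \<open>square_sum_ge\<close> is enough.\<close>

lemma square_sum_lower:
  assumes d: "d \<ge> 1" and k: "1 \<le> k" "k \<le> Suc N"
  shows "int k * int (card (jump_sets d N)) \<le> 128 * 2 ^ d * square_sum d N k"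
proof (cases "4 * d + 4 \<le> k")
  case True
  define t where "t = (k - (2 * d + 1)) div 2"
  define r where "r = k - 2 * t"
  have rt: "k = r + 2 * t" "2 * d + 1 \<le> r" "k \<le> 4 * t"
    using True by (auto simp: r_def t_def)
  have "int k * int (card (jump_sets d N)) \<le> int (4 * t) * int (card (jump_sets d N))"
    using rt(3) by (intro mult_right_mono) auto
  also have "\<dots> \<le> 128 * 2 ^ d * square_sum d N k" using square_sum_linear[OF d rt(2), of t N] rt(1) k by simp
  finally show ?thesis .
next
  case False
  have "d + 1 \<le> 2 ^ d" by (induction d) auto
  then have "4 * d + 4 \<le> 128 * 2 ^ d" by simp
  then have "k \<le> 128 * 2 ^ d" using False by linarith
  then have "int k \<le> int (128 * 2 ^ d)" by (simp only: of_nat_le_iff)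
  then have "int k \<le> 128 * 2 ^ d" by simp
  moreover have "int (card (jump_sets d N)) \<le> square_sum d N k" using square_sum_ge[OF d, of "k - 1" N] k by simp
  ultimately show ?thesis by (intro mult_mono) auto
qed


section \<open>Correspondence between jump sets and homomorphisms\<close>

lemma height_const:
  assumes "\<And>t. t < r \<Longrightarrow> Suc (q + 2 * t) \<notin> J"
  shows "height J (q + 2 * r) = height J q"
  using assms
proof (induction r)
  case (Suc r)
  then show ?case using height_Suc_Suc[of J "q + 2 * r"] by simp
qed simp

text \<open>Strictly between \<open>i\<close> and \<open>j\<close> jumps of only one parity can
  occur. Hence the height is unchanged either from \<open>i\<close> to \<open>j - 1\<close> or from
  \<open>i + 1\<close> to \<open>j\<close>, and a single step remains.\<close>

lemma height_adjacent:
  assumes sep: "separated d J" and ij: "i < j" "odd (j - i)" "j - i \<le> 2 * d + 1"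
  shows "\<bar>height J i - height J j\<bar> = 1"
proof -
  obtain r where "j - i = 2 * r + 1" using ij(2) by (blast elim: oddE)
  then have r: "j = Suc (i + 2 * r)" using ij(1) by simp
  have r_le: "r \<le> d" using ij(3) r by simp
  show ?thesis
  proof (cases "\<exists>t<r. Suc (i + 2 * t) \<in> J")
    case True
    then obtain t where t: "t < r" "Suc (i + 2 * t) \<in> J" by blast
    have "Suc (Suc i + 2 * u) \<notin> J" if u: "u < r" for u
    proof
      assume *: "Suc (Suc i + 2 * u) \<in> J"
      show False
      proof (cases "t \<le> u")
        case True
        have "odd (Suc (Suc i + 2 * u) - Suc (i + 2 * t))" using True by presburger
        then show False using separatedD[OF sep t(2) *] True u r_le by auto
      next
        case False
        have "odd (Suc (i + 2 * t) - Suc (Suc i + 2 * u))" using False by presburger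
        then show False using separatedD[OF sep * t(2)] False t(1) r_le by auto
      qed
    qed
    then have "height J (Suc i + 2 * r) = height J (Suc i)" by (rule height_const)
    then show ?thesis by (simp add: r height_Suc)
  next
    case False
    then have "height J (i + 2 * r) = height J i" by (intro height_const) blast
    then show ?thesis by (simp add: r height_Suc)
  qed
qed

text \<open>The sign is the value at vertex 1.\<close>

definition hom_of :: "nat \<Rightarrow> int \<times> nat set \<Rightarrow> nat \<Rightarrow> int" where
  "hom_of n = (\<lambda>(s, J). restrict (\<lambda>k. s * height J k) {0..n})"

lemma P_adj_sym: "P_adj n d i j \<Longrightarrow> P_adj n d j i"
  by (simp add: P_adj_def abs_minus_commute)

lemma P_adjI:
  assumes "i \<le> n" "j \<le> n" "i < j" "odd (j - i)" "j - i \<le> 2 * d + 1"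
  shows "P_adj n d i j" "P_adj n d j i"
proof -
  obtain m where m: "j - i = 2 * m + 1" using assms(4) by (blast elim: oddE)
  then have "\<bar>int i - int j\<bar> = 2 * int m + 1" "m \<le> d" using assms(3,5) by auto
  then show "P_adj n d i j" using assms unfolding P_adj_def P_verts_def by auto
  then show "P_adj n d j i" by (rule P_adj_sym)
qed

lemma P_adjE:
  assumes "P_adj n d i j" "i < j"
  shows "j \<le> n" "odd (j - i)" "j - i \<le> 2 * d + 1"
proof -
  obtain m where m: "m \<le> d" "\<bar>int i - int j\<bar> = 2 * int m + 1" and "j \<le> n"
    using assms unfolding P_adj_def P_verts_def by auto
  then have "j - i = 2 * m + 1" using assms(2) by linarith
  then show "odd (j - i)" "j - i \<le> 2 * d + 1" using m by auto
qed (use assms in \<open>auto simp: P_adj_def P_verts_def\<close>)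

lemma hom_of_in_Hom_P:
  assumes "s \<in> {-1, 1}" "separated d J"
  shows "hom_of n (s, J) \<in> Hom_P n d"
proof -
  have lt: "\<bar>s * height J i - s * height J j\<bar> = 1" if "P_adj n d i j" "i < j" for i j
    using height_adjacent[OF assms(2) that(2) P_adjE(2,3)[OF that]] assms(1)
    by (auto simp flip: right_diff_distrib simp: abs_mult)
  have "\<bar>s * height J i - s * height J j\<bar> = 1" if adj: "P_adj n d i j" for i j
  proof (cases i j rule: linorder_cases)
    case equal
    then show ?thesis using adj by (auto simp: P_adj_def)
  next
    case greater
    then show ?thesis using lt[OF P_adj_sym[OF adj]] by (simp add: abs_minus_commute)
  qed (rule lt[OF adj])
  then show ?thesis by (auto simp: Hom_P_def hom_of_def P_verts_def P_adj_def)
qed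

lemma Hom_P_step:
  assumes f: "f \<in> Hom_P n d" and "i \<le> n" "j \<le> n" "i < j" "odd (j - i)" "j - i \<le> 2 * d + 1"
  shows "\<bar>f i - f j\<bar> = 1"
  using f P_adjI(1)[OF assms(2-)] by (simp add: Hom_P_def)

text \<open>If jumps \<open>a < b\<close> are at a shorter odd distance, each of
  \<open>a - 1\<close>, \<open>a + 1\<close> is adjacent to each of \<open>b - 1\<close>,
  \<open>b + 1\<close>. The values at the first pair differ by 2, so both values at the second pair
  equal their midpoint, and \<open>b\<close> is no jump.\<close>

lemma Hom_P_turns_separated:
  assumes d: "d \<ge> 1" and f: "f \<in> Hom_P n d"
  shows "separated d {i \<in> {1..n - 1}. f (i - 1) \<noteq> f (i + 1)}"
  unfolding separated_def
proof (intro ballI impI, rule ccontr)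
  fix a b
  assume a: "a \<in> {i \<in> {1..n - 1}. f (i - 1) \<noteq> f (i + 1)}"
    and b: "b \<in> {i \<in> {1..n - 1}. f (i - 1) \<noteq> f (i + 1)}"
    and ab: "a < b" "odd (b - a)" "\<not> 2 * d + 1 \<le> b - a"
  define a' b' where "a' = a - 1" and "b' = b - 1"
  have ab': "a = Suc a'" "b = Suc b'" using a b by (auto simp: a'_def b'_def)
  have bn: "b' + 2 \<le> n" using b ab' by auto
  have o: "odd (b' - a')" "a' < b'" "b' - a' < 2 * d" using ab ab' by (auto; presburger)+
  have e1: "\<bar>f a' - f b'\<bar> = 1"
    using o bn by (intro Hom_P_step[OF f]) auto
  have e2: "\<bar>f a' - f (b' + 2)\<bar> = 1"
    using o bn by (intro Hom_P_step[OF f]) (auto; presburger)+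
  have e3: "\<bar>f (a' + 2) - f (b' + 2)\<bar> = 1"
    using o bn by (intro Hom_P_step[OF f]) auto
  have e4: "\<bar>f (a' + 2) - f b'\<bar> = 1"
  proof (cases "a' + 2 < b'")
    case True
    then show ?thesis using o bn by (intro Hom_P_step[OF f]) (auto; presburger)+
  next
    case False
    then have "b' = a' + 1" using o by presburger
    then have "\<bar>f b' - f (a' + 2)\<bar> = 1" using bn d by (intro Hom_P_step[OF f]) auto
    then show ?thesis by (simp add: abs_minus_commute)
  qed
  have "f a' \<noteq> f (a' + 2)" "f b' \<noteq> f (b' + 2)" using a b ab' by auto
  then show False using e1 e2 e3 e4 by linarith
qed

text \<open>Only the inner vertices \<open>{1..n - 1}\<close> can be jumps. The inverse reads off
  the value at 1 and the jumps.\<close>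

lemma bij_betw_hom_of:
  assumes d: "d \<ge> 1" and n: "n \<ge> 1"
  shows "bij_betw (hom_of n) ({-1, 1} \<times> jump_sets d (n - 1)) (Hom_P n d)"
proof (rule bij_betw_byWitness[where f' = "\<lambda>f. (f 1, {i \<in> {1..n - 1}. f (i - 1) \<noteq> f (i + 1)})"])
  show "hom_of n ` ({-1, 1} \<times> jump_sets d (n - 1)) \<subseteq> Hom_P n d"
    using hom_of_in_Hom_P by (auto simp: jump_sets_def)
  have f1: "f 1 \<in> {-1, 1}" if "f \<in> Hom_P n d" for f
    using Hom_P_step[OF that, of 0 1] n that by (auto simp: Hom_P_def abs_if split: if_splits)
  then show "(\<lambda>f. (f 1, {i \<in> {1..n - 1}. f (i - 1) \<noteq> f (i + 1)})) ` Hom_P n d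
      \<subseteq> {-1, 1} \<times> jump_sets d (n - 1)"
    using Hom_P_turns_separated[OF d] by (auto simp: jump_sets_def simp del: One_nat_def)
  show "\<forall>x\<in>{-1, 1} \<times> jump_sets d (n - 1).
      (hom_of n x 1, {i \<in> {1..n - 1}. hom_of n x (i - 1) \<noteq> hom_of n x (i + 1)}) = x"
  proof
    fix x :: "int \<times> nat set" assume "x \<in> {-1, 1} \<times> jump_sets d (n - 1)"
    then obtain s J where x: "x = (s, J)" "s \<in> {-1, 1}" "J \<subseteq> {1..n - 1}" by (auto simp: jump_sets_def)
    have "hom_of n x (i - 1) \<noteq> hom_of n x (i + 1) \<longleftrightarrow> i \<in> J" if i: "i \<in> {1..n - 1}" for i
    proof -
      obtain i' where i': "i = Suc i'" using i by (cases i) auto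
      have "step J i' \<noteq> 0" by (metis abs_step abs_zero zero_neq_one)
      then show ?thesis using i i' x(2) by (auto simp: hom_of_def x(1) height_Suc_Suc)
    qed
    then have "{i \<in> {1..n - 1}. hom_of n x (i - 1) \<noteq> hom_of n x (i + 1)} = J"
      using x(3) by blast
    moreover have "hom_of n x 1 = s" using n by (simp add: hom_of_def x(1) height_Suc)
    ultimately show "(hom_of n x 1, {i \<in> {1..n - 1}. hom_of n x (i - 1) \<noteq> hom_of n x (i + 1)}) = x"
      using x(1) by simp
  qed
  show "\<forall>f\<in>Hom_P n d. hom_of n (f 1, {i \<in> {1..n - 1}. f (i - 1) \<noteq> f (i + 1)}) = f"
  proof
    fix f assume f: "f \<in> Hom_P n d"
    define J where "J = {i \<in> {1..n - 1}. f (i - 1) \<noteq> f (i + 1)}"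
    have f0: "f 0 = 0" using f by (simp add: Hom_P_def)
    have unit: "\<bar>f i - f (Suc i)\<bar> = 1" if "Suc i \<le> n" for i
      using that by (intro Hom_P_step[OF f]) auto
    \<comment> \<open>The increments of \<open>f\<close> keep their sign at jumps and reverse it
      elsewhere, as \<open>step\<close> does.\<close>
    have "f (Suc i) - f i = f 1 * step J i" if "Suc i \<le> n" for i
      using that
    proof (induction i)
      case 0
      then show ?case using f0 by simp
    next
      case (Suc i)
      have "Suc i \<in> J \<longleftrightarrow> f i \<noteq> f (Suc (Suc i))" using Suc(2) by (auto simp: J_def)
      then have "f (Suc (Suc i)) - f (Suc i) = (if Suc i \<in> J then f (Suc i) - f i else - (f (Suc i) - f i))"
        using unit[of i] unit[of "Suc i"] Suc(2) by auto
      then show ?case using Suc by (simp add: step_Suc)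
    qed
    note inc = this
    have "f k = f 1 * height J k" if "k \<le> n" for k
      using that
    proof (induction k)
      case (Suc k)
      then show ?case using inc[of k] by (simp add: height_Suc algebra_simps)
    qed (simp add: f0)
    moreover have "f k = undefined" if "\<not> k \<le> n" for k
      using f that by (auto simp: Hom_P_def P_verts_def PiE_def extensional_def)
    ultimately show "hom_of n (f 1, {i \<in> {1..n - 1}. f (i - 1) \<noteq> f (i + 1)}) = f"
      unfolding J_def[symmetric] by (auto simp: hom_of_def restrict_def)
  qed
qed

section \<open>The variance and its bounds\<close>

lemma variance_Hom_P:
  assumes d: "d \<ge> 1" and k: "1 \<le> k" "k \<le> n"
  shows "measure_pmf.variance (pmf_of_set (Hom_P n d)) (\<lambda>f. real_of_int (f k))
    = real_of_int (square_sum d (n - 1) k) / real (card (jump_sets d (n - 1)))"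
proof -
  let ?C = "jump_sets d (n - 1)"
  have n: "n \<ge> 1" using k by simp
  have E: "measure_pmf.expectation (pmf_of_set (Hom_P n d)) X = sum X (Hom_P n d) / card (Hom_P n d)"
    for X :: "(nat \<Rightarrow> int) \<Rightarrow> real"
    by (rule integral_pmf_of_set[OF Hom_P_nonempty finite_Hom_P])
  have S: "sum X (Hom_P n d) = (\<Sum>J\<in>?C. X (hom_of n (-1, J))) + (\<Sum>J\<in>?C. X (hom_of n (1, J)))"
    for X :: "(nat \<Rightarrow> int) \<Rightarrow> real"
    by (subst sum.reindex_bij_betw[OF bij_betw_hom_of[OF d n], symmetric])
      (simp add: sum.cartesian_product')
  have hk: "hom_of n (s, J) k = s * height J k" for s J using k by (simp add: hom_of_def)
  \<comment> \<open>Each jump set carries two signs with equal squares, so this factor 2 cancels in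
    the second moment.\<close>
  have "real (card (Hom_P n d)) = 2 * real (card ?C)"
    using S[of "\<lambda>_. 1"] by simp
  \<comment> \<open>The two signs contribute opposite values.\<close>
  moreover have mean: "measure_pmf.expectation (pmf_of_set (Hom_P n d)) (\<lambda>f. real_of_int (f k)) = 0"
    by (simp add: E S hk sum_negf)
  ultimately show ?thesis
    unfolding mean by (simp add: E S hk square_sum_def)
qed

theorem theorem2p4:
  "\<exists>C c :: real. C > 0 \<and> c > 0 \<and>
     (\<forall>n d k :: nat. n \<ge> 1 \<longrightarrow> d \<ge> 1 \<longrightarrow> 1 \<le> k \<longrightarrow> k \<le> n \<longrightarrow>
        max (c * real k / 2 ^ d) 1
          \<le> measure_pmf.variance (pmf_of_set (Hom_P n d)) (\<lambda>f. real_of_int (f k)) \<and>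
        measure_pmf.variance (pmf_of_set (Hom_P n d)) (\<lambda>f. real_of_int (f k))
          \<le> C * real k / 2 ^ d + 4)"
proof (rule exI[of _ 6], rule exI[of _ "1 / 128"], intro conjI allI impI)
  \<comment> \<open>The constant 6 comes from \<open>square_sum_le\<close> and 1/128 from
    \<open>square_sum_lower\<close>.\<close>
  fix n d k :: nat
  assume "n \<ge> 1" and d: "d \<ge> 1" and k: "1 \<le> k" "k \<le> n"
  define Z where "Z = real (card (jump_sets d (n - 1)))"
  define v where "v = real_of_int (square_sum d (n - 1) k)"
  have var: "measure_pmf.variance (pmf_of_set (Hom_P n d)) (\<lambda>f. real_of_int (f k)) = v / Z"
    unfolding v_def Z_def by (rule variance_Hom_P[OF d k])
  have kn: "k \<le> Suc (n - 1)" using k by simp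
  have "{} \<in> jump_sets d (n - 1)" by (simp add: jump_sets_def separated_def)
  then have Z: "Z > 0" unfolding Z_def by (auto simp: card_gt_0_iff)
  have "real_of_int (int k * int (card (jump_sets d (n - 1)))) \<le> real_of_int (128 * 2 ^ d * square_sum d (n - 1) k)"
    using square_sum_lower[OF d k(1) kn] by (simp only: of_int_le_iff)
  then have 1: "real k * Z \<le> 128 * 2 ^ d * v" by (simp add: Z_def v_def)
  have "real_of_int (int (card (jump_sets d (n - 1)))) \<le> real_of_int (square_sum d (n - 1) k)"
    using square_sum_ge[OF d, of "k - 1" "n - 1"] k by (simp only: of_int_le_iff) simp
  then have 2: "Z \<le> v" by (simp add: Z_def v_def)
  have "real_of_int (2 ^ d * square_sum d (n - 1) k) \<le> real_of_int ((4 * 2 ^ d + 6 * int k) * int (card (jump_sets d (n - 1))))"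
    using square_sum_le[OF d kn] by (simp only: of_int_le_iff)
  then have 3: "2 ^ d * v \<le> (4 * 2 ^ d + 6 * real k) * Z" by (simp add: Z_def v_def)
  show "max (1 / 128 * real k / 2 ^ d) 1
      \<le> measure_pmf.variance (pmf_of_set (Hom_P n d)) (\<lambda>f. real_of_int (f k))"
    unfolding var using 1 2 Z by (simp add: field_simps)
  show "measure_pmf.variance (pmf_of_set (Hom_P n d)) (\<lambda>f. real_of_int (f k)) \<le> 6 * real k / 2 ^ d + 4"
    unfolding var using 3 Z by (simp add: field_simps)
qed simp_all

end
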